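(* The satisfiability problem for GPC is PTIME-reducible to the transformation consistency problem.
   Context: **The two problems.** Satisfiability problem for GPC: given a GPC pattern (query) $P$, check if $P$ is satisfiable, i.e. returns a non-empty set of answers on some property graph. Transformation consistency problem: given a property graph transformation $T$, check if $T$ is consistent (there is no schema constraining the possible input property graphs). All notions are defined below. **Property graphs.** Let $\mathcal O,\mathcal L,\mathcal K,\mathsf{Const}$ be disjoint countable sets of object identifiers, labels, keys (property names) and constants. A property graph is $G=\langle N,E,\lambda,\mathsf{src},\mathsf{tgt},\delta\rangle$ where $N,E\subset\mathcal O$ are finite disjoint sets (nodes, edges), $\lambda:N\cup E\to 2^{\mathcal L}$ assigns to each element a finite (possibly empty) set of labels, $\mathsf{src},\mathsf{tgt}:E\to N$, and $\delta:(N\cup E)\times\mathcal K\to\mathsf{Const}$ is a partial function with finite domain. A path is an alternating sequence $(n_0,e_1,n_1,\dots,e_k,n_k)$ of nodes and edges (edges may be traversed forward or backward) with length $k\ge 0$; two paths concatenate if the last node of the first equals the first node of the second. **GPC syntax.** Path patterns: $\pi ::= (x:\ell)\mid \xrightarrow{x:\ell}\mid\xleftarrow{x:\ell}\mid \pi+\pi\mid\pi\,\pi\mid\pi_{\langle\theta\rangle}\mid\pi^{n..m}$, where the variable $x$ and label $\ell\in\mathcal L$ are optional, $n\in\mathbb N$, $m\in\mathbb N\cup\{\infty\}$, $n \le m$. Conditions: $\theta::= x.a=c\mid x.a=y.b\mid\theta\wedge\theta\mid\theta\vee\theta\mid\neg\theta$ with $a,b\in\mathcal K$, $c\in\mathsf{Const}$.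 Queries (graph patterns): $Q::=\rho\,\pi\mid Q,Q\mid Q_{\langle\theta\rangle}$ with restrictor $\rho\in\{\mathsf{simple},\mathsf{trail},\mathsf{shortest}\}$. **Types.** Queries must be well-typed. A variable of a node (edge) pattern has type $\mathsf{Node}$ ($\mathsf{Edge}$). In $\pi^{n..m}$, a variable of type $\tau$ in $\pi$ gets type $\mathsf{Group}(\tau)$. In $\pi_1+\pi_2$, a variable with the same type $\tau$ in both gets $\tau$; a variable with types $\tau$ and $\mathsf{Maybe}(\tau)$ gets $\mathsf{Maybe}(\tau)$; a variable occurring in only one of them with type $\tau$ gets $\mathsf{Maybe}(\tau)$ (or $\tau$ if already a $\mathsf{Maybe}$ type); otherwise the pattern is ill-typed. In $\pi_1\pi_2$ and in $Q_1,Q_2$, a variable occurring in both must have the same type in both, being $\mathsf{Node}$ or $\mathsf{Edge}$; other variables keep their type. In $\pi_{\langle\theta\rangle}$ and $Q_{\langle\theta\rangle}$, variables of $\theta$ must have type $\mathsf{Node}$ or $\mathsf{Edge}$ in $\pi$, resp. $Q$. Variables of type $\mathsf{Node}$ or $\mathsf{Edge}$ in an expression are its singleton variables. **Semantics.** (Only values of singleton variables matter, so bindings are recorded on singleton variables only.) $\llbracket\pi\rrbracket_G$ is a set of pairs $(p,\mu)$, $p$ a path in $G$ and $\mu$ an assignment of elements of $G$ to the singleton variables of $\pi$: a node pattern matches each single-node path $(n)$ with $\ell\in\lambda(n)$ (if $\ell$ is given), $\mu(x)=n$; $\xrightarrow{x:\ell}$ matches $(\mathsf{src}(e),e,\mathsf{tgt}(e))$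 and $\xleftarrow{x:\ell}$ matches $(\mathsf{tgt}(e),e,\mathsf{src}(e))$ with $\ell\in\lambda(e)$ (if $\ell$ is given), $\mu(x)=e$; $\pi_1+\pi_2$ is the union (assignments restricted to singleton variables of $\pi_1+\pi_2$); $\pi_1\pi_2$ consists of $(p_1p_2,\mu_1\cup\mu_2)$ for $(p_i,\mu_i)\in\llbracket\pi_i\rrbracket_G$ such that $p_1,p_2$ concatenate and $\mu_1,\mu_2$ agree on common variables; $\pi_{\langle\theta\rangle}$ keeps those $(p,\mu)$ with $\mu\models\theta$; $\pi^{n..m}$ consists of $(p_1\cdots p_k,\emptyset)$ with $n\le k\le m$, $k$ finite, and each $p_i$ the path of some match of $\pi$ ($k=0$ gives all single-node paths). Here $\mu\models x.a=c$ iff $\delta(\mu(x),a)$ is defined and equals $c$; $\mu\models x.a=y.b$ iff $\delta(\mu(x),a)$ and $\delta(\mu(y),b)$ are both defined and equal; Boolean connectives are classical. $\rho\,\pi$ keeps the matches whose path repeats no node ($\mathsf{simple}$), repeats no edge ($\mathsf{trail}$), or has minimal length among all matches of $\pi$ with the same two endpoints ($\mathsf{shortest}$). $Q_1,Q_2$ returns unions $\mu_1\cup\mu_2$ of answers agreeing on common variables; $Q_{\langle\theta\rangle}$ filters by $\theta$. For a tuple $\bar x$ (possibly empty) of singleton variables of a query $P$, $\llbracket P\rrbracket^{\bar x}_G$ is the set of bindings of $\bar x$ returned by $P$ on $G$. **Transformations.** Identifiers of input graphs come from a countable set $\mathcal S\subset\mathcal O$, those of output graphs from a countable set $\mathcal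 T\subset\mathcal O\setminus\mathcal S$; $f:\bigcup_{k\in\mathbb N}(\mathcal O\cup\mathsf{Const}\cup\mathcal L)^k\to\mathcal T$ is a fixed injective function. A content constructor $C(\bar x)$ consists of: $C.\mathrm{Id}=(a_1,\dots,a_k)$, each $a_i$ being a constant, a label, a variable $x\in\bar x$, or an expression $x.a$ with $x\in\bar x$, $a\in\mathcal K$; $C.\mathrm{Labels}$, a finite set of labels; and $C.\mathrm{Properties}=\langle k_1=v_1,\dots,k_n=v_n\rangle$ with $k_i\in\mathcal K$ and each $v_i$ a constant or an expression $x.a$ with $x\in\bar x$, $a\in\mathcal K$. A node rule is $P(\bar x)\Rightarrow(C(\bar x))$ and an edge rule is $P(\bar x)\Rightarrow(C_{\mathrm s}(\bar x))\xrightarrow{C(\bar x)}(C_{\mathrm t}(\bar x))$, with $P$ a GPC query with singleton variables $\bar x$ and $C,C_{\mathrm s},C_{\mathrm t}$ content constructors. A (property graph) transformation is a finite set of rules. For a binding $\bar o$ of $\bar x$ over $G$, $C.\mathrm{Id}(\bar o)$ is obtained from $C.\mathrm{Id}$ by replacing each $x_j$ by $o_j$ and each $x_j.a$ by $\delta_G(o_j,a)$, and $C.\mathrm{Properties}(\bar o)$ is obtained from $C.\mathrm{Properties}$ by replacing each $x_j.a$ by $\delta_G(o_j,a)$. **Execution of $T$ on $G$.** Start from the empty property graph. For each edge rule of $T$ add the node rules $P(\bar x)\Rightarrow(C_{\mathrm s}(\bar x))$ and $P(\bar x)\Rightarrow(C_{\mathrm t}(\bar x))$. Then, in an arbitrary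 order, for each node rule and each $\bar o\in\llbracket P\rrbracket^{\bar x}_G$: add node $o:=f(C.\mathrm{Id}(\bar o))$ to $N$ (if not yet present), add $C.\mathrm{Labels}$ to $\lambda(o)$, and set $\delta(o,k)$ to $c$ if $C.\mathrm{Properties}(\bar o)$ sets property $k$ to $c$. Then, in an arbitrary order, for each edge rule and each $\bar o\in\llbracket P\rrbracket^{\bar x}_G$: let $o_{\mathrm s}=f(C_{\mathrm s}.\mathrm{Id}(\bar o))$, $o_{\mathrm t}=f(C_{\mathrm t}.\mathrm{Id}(\bar o))$; add edge $o:=f(o_{\mathrm s},C.\mathrm{Id}(\bar o),o_{\mathrm t})$ to $E$, set $\mathsf{src}(o)=o_{\mathrm s}$, $\mathsf{tgt}(o)=o_{\mathrm t}$, add $C.\mathrm{Labels}$ to $\lambda(o)$, and set $\delta(o,k)$ to $c$ if $C.\mathrm{Properties}(\bar o)$ sets property $k$ to $c$. **Consistency.** A conflict is a situation where the execution resets a previously set property of an element to a different value. $T$ is consistent if for every input property graph $G$, no execution on $G$ results in a conflict. *)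

theory Defs
  imports "HOL-Library.FSet" "HOL-Library.Extended_Nat" "HOL-Computational_Algebra.Polynomial"
begin

section \<open>Property graphs\<close>

text \<open>
  Each of the four disjoint countable sets of identifiers, labels, keys and constants is
  represented by its own copy of the natural numbers.  Where elements of different sets occur
  side by side (in the arguments of the identifier function of a transformation) they are tagged,
  see \<open>atom\<close> below.
\<close>

type_synonym oid = nat
type_synonym label = nat
type_synonym key = nat
type_synonym const = nat
type_synonym var = nat

record pgraph =
  nodes :: "oid set"
  edges :: "oid set"
  labs :: "oid \<Rightarrow> label set"
  src :: "oid \<Rightarrow> oid"
  tgt :: "oid \<Rightarrow> oid"
  attr :: "oid \<Rightarrow> key \<Rightarrow> const option"

definition property_graph :: "pgraph \<Rightarrow> bool" where
  "property_graph G \<longleftrightarrow>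
     finite (nodes G) \<and> finite (edges G) \<and> nodes G \<inter> edges G = {} \<and>
     (\<forall>x \<in> nodes G \<union> edges G. finite (labs G x)) \<and>
     (\<forall>e \<in> edges G. src G e \<in> nodes G \<and> tgt G e \<in> nodes G) \<and>
     finite {(x, a). attr G x a \<noteq> None} \<and>
     (\<forall>x a. attr G x a \<noteq> None \<longrightarrow> x \<in> nodes G \<union> edges G)"

text \<open>
  A path is the alternating list \<open>[n\<^sub>0, e\<^sub>1, n\<^sub>1, \<dots>, e\<^sub>k, n\<^sub>k]\<close>: nodes at even and edges at odd
  positions.
\<close>

type_synonym path = "oid list"

definition path_nodes :: "path \<Rightarrow> oid list" where
  "path_nodes p = nths p {i. even i}"

definition path_edges :: "path \<Rightarrow> oid list" where
  "path_edges p = nths p {i. odd i}"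

definition path_length :: "path \<Rightarrow> nat" where
  "path_length p = length (path_edges p)"

definition concatenate :: "path \<Rightarrow> path \<Rightarrow> bool" where
  "concatenate p q \<longleftrightarrow> last p = hd q"

definition path_concat :: "path \<Rightarrow> path \<Rightarrow> path" where
  "path_concat p q = p @ tl q"


section \<open>Syntax of GPC\<close>

datatype cond =
    CConst var key const
  | CProp var key var key
  | CAnd cond cond
  | COr cond cond
  | CNot cond

datatype pattern =
    PNode "var option" "label option"
  | PForward "var option" "label option"
  | PBackward "var option" "label option"
  | PUnion pattern pattern
  | PConcat pattern pattern
  | PCond pattern cond
  | PRepeat pattern nat enat

datatype restrictor = Simple | Trail | Shortest

datatype gpc =
    QPath restrictor pattern
  | QJoin gpc gpc
  | QCond gpc cond

fun cond_vars :: "cond \<Rightarrow> var set" where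
  "cond_vars (CConst x a c) = {x}"
| "cond_vars (CProp x a y b) = {x, y}"
| "cond_vars (CAnd s t) = cond_vars s \<union> cond_vars t"
| "cond_vars (COr s t) = cond_vars s \<union> cond_vars t"
| "cond_vars (CNot t) = cond_vars t"


section \<open>Types\<close>

datatype gtype = TNode | TEdge | TGroup gtype | TMaybe gtype

type_synonym schema = "var \<Rightarrow> gtype option"

definition singles :: "schema \<Rightarrow> var set" where
  "singles \<Gamma> = {x. \<Gamma> x = Some TNode \<or> \<Gamma> x = Some TEdge}"

fun maybe :: "gtype \<Rightarrow> gtype" where
  "maybe (TMaybe t) = TMaybe t"
| "maybe t = TMaybe t"

text \<open>
  The type in \<open>\<pi>\<^sub>1 + \<pi>\<^sub>2\<close> of a variable with types \<open>s\<close> and \<open>t\<close> in \<open>\<pi>\<^sub>1\<close> and \<open>\<pi>\<^sub>2\<close>; \<open>None\<close> if they are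
  incompatible.
\<close>

definition union_type :: "gtype \<Rightarrow> gtype \<Rightarrow> gtype option" where
  "union_type s t =
     (if s = t then Some t
      else if t = TMaybe s then Some t
      else if s = TMaybe t then Some s
      else None)"

definition union_schema :: "schema \<Rightarrow> schema \<Rightarrow> schema option" where
  "union_schema \<Gamma> \<Delta> =
     (if \<forall>x s t. \<Gamma> x = Some s \<longrightarrow> \<Delta> x = Some t \<longrightarrow> union_type s t \<noteq> None
      then Some (\<lambda>x. case (\<Gamma> x, \<Delta> x) of
             (Some s, Some t) \<Rightarrow> union_type s t
           | (Some s, None) \<Rightarrow> Some (maybe s)
           | (None, Some t) \<Rightarrow> Some (maybe t)
           | (None, None) \<Rightarrow> None)
      else None)"

definition join_schema :: "schema \<Rightarrow> schema \<Rightarrow> schema option" where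
  "join_schema \<Gamma> \<Delta> =
     (if \<forall>x \<in> dom \<Gamma> \<inter> dom \<Delta>. \<Gamma> x = \<Delta> x \<and> x \<in> singles \<Gamma> then Some (\<Gamma> ++ \<Delta>) else None)"

definition var_schema :: "var option \<Rightarrow> gtype \<Rightarrow> schema" where
  "var_schema v t = (case v of None \<Rightarrow> Map.empty | Some x \<Rightarrow> [x \<mapsto> t])"

text \<open>
  \<open>None\<close> means that the expression is ill-typed.  The syntactic requirement \<open>n \<le> m\<close> on
  repetitions \<open>\<pi>\<^bsup>n..m\<^esup>\<close> is checked here as well.
\<close>

fun pattern_schema :: "pattern \<Rightarrow> schema option" where
  "pattern_schema (PNode v l) = Some (var_schema v TNode)"
| "pattern_schema (PForward v l) = Some (var_schema v TEdge)"
| "pattern_schema (PBackward v l) = Some (var_schema v TEdge)"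
| "pattern_schema (PUnion \<pi> \<rho>) =
     (case (pattern_schema \<pi>, pattern_schema \<rho>) of
        (Some \<Gamma>, Some \<Delta>) \<Rightarrow> union_schema \<Gamma> \<Delta> | _ \<Rightarrow> None)"
| "pattern_schema (PConcat \<pi> \<rho>) =
     (case (pattern_schema \<pi>, pattern_schema \<rho>) of
        (Some \<Gamma>, Some \<Delta>) \<Rightarrow> join_schema \<Gamma> \<Delta> | _ \<Rightarrow> None)"
| "pattern_schema (PCond \<pi> \<theta>) =
     (case pattern_schema \<pi> of
        Some \<Gamma> \<Rightarrow> if cond_vars \<theta> \<subseteq> singles \<Gamma> then Some \<Gamma> else None | None \<Rightarrow> None)"
| "pattern_schema (PRepeat \<pi> n m) =
     (case pattern_schema \<pi> of
        Some \<Gamma> \<Rightarrow> if enat n \<le> m then Some (map_option TGroup \<circ> \<Gamma>) else None | None \<Rightarrow> None)"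

fun gpc_schema :: "gpc \<Rightarrow> schema option" where
  "gpc_schema (QPath r \<pi>) = pattern_schema \<pi>"
| "gpc_schema (QJoin P Q) =
     (case (gpc_schema P, gpc_schema Q) of
        (Some \<Gamma>, Some \<Delta>) \<Rightarrow> join_schema \<Gamma> \<Delta> | _ \<Rightarrow> None)"
| "gpc_schema (QCond Q \<theta>) =
     (case gpc_schema Q of
        Some \<Gamma> \<Rightarrow> if cond_vars \<theta> \<subseteq> singles \<Gamma> then Some \<Gamma> else None | None \<Rightarrow> None)"

definition well_typed :: "gpc \<Rightarrow> bool" where
  "well_typed Q \<longleftrightarrow> gpc_schema Q \<noteq> None"

definition pattern_singles :: "pattern \<Rightarrow> var set" where
  "pattern_singles \<pi> = (case pattern_schema \<pi> of Some \<Gamma> \<Rightarrow> singles \<Gamma> | None \<Rightarrow> {})"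

definition gpc_singles :: "gpc \<Rightarrow> var set" where
  "gpc_singles Q = (case gpc_schema Q of Some \<Gamma> \<Rightarrow> singles \<Gamma> | None \<Rightarrow> {})"


section \<open>Semantics of GPC\<close>

type_synonym assignment = "var \<Rightarrow> oid option"

definition var_prop :: "pgraph \<Rightarrow> assignment \<Rightarrow> var \<Rightarrow> key \<Rightarrow> const option" where
  "var_prop G \<mu> x a = (case \<mu> x of Some v \<Rightarrow> attr G v a | None \<Rightarrow> None)"

fun sat :: "pgraph \<Rightarrow> assignment \<Rightarrow> cond \<Rightarrow> bool" where
  "sat G \<mu> (CConst x a c) \<longleftrightarrow> var_prop G \<mu> x a = Some c"
| "sat G \<mu> (CProp x a y b) \<longleftrightarrow> (\<exists>c. var_prop G \<mu> x a = Some c \<and> var_prop G \<mu> y b = Some c)"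
| "sat G \<mu> (CAnd s t) \<longleftrightarrow> sat G \<mu> s \<and> sat G \<mu> t"
| "sat G \<mu> (COr s t) \<longleftrightarrow> sat G \<mu> s \<or> sat G \<mu> t"
| "sat G \<mu> (CNot t) \<longleftrightarrow> \<not> sat G \<mu> t"

definition var_assignment :: "var option \<Rightarrow> oid \<Rightarrow> assignment" where
  "var_assignment v u = (case v of None \<Rightarrow> Map.empty | Some x \<Rightarrow> [x \<mapsto> u])"

definition label_ok :: "pgraph \<Rightarrow> label option \<Rightarrow> oid \<Rightarrow> bool" where
  "label_ok G l u \<longleftrightarrow> (case l of None \<Rightarrow> True | Some a \<Rightarrow> a \<in> labs G u)"

definition agree :: "assignment \<Rightarrow> assignment \<Rightarrow> bool" where
  "agree \<mu> \<nu> \<longleftrightarrow> (\<forall>x \<in> dom \<mu> \<inter> dom \<nu>. \<mu> x = \<nu> x)"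

text \<open>The concatenations of \<open>k\<close> paths from \<open>A\<close>; for \<open>k = 0\<close> these are the single-node paths.\<close>

fun path_power :: "pgraph \<Rightarrow> path set \<Rightarrow> nat \<Rightarrow> path set" where
  "path_power G A 0 = {[n] |n. n \<in> nodes G}"
| "path_power G A (Suc k) =
     {path_concat p q |p q. p \<in> A \<and> q \<in> path_power G A k \<and> concatenate p q}"

fun pattern_sem :: "pgraph \<Rightarrow> pattern \<Rightarrow> (path \<times> assignment) set" where
  "pattern_sem G (PNode v l) =
     {([n], var_assignment v n) |n. n \<in> nodes G \<and> label_ok G l n}"
| "pattern_sem G (PForward v l) =
     {([src G e, e, tgt G e], var_assignment v e) |e. e \<in> edges G \<and> label_ok G l e}"
| "pattern_sem G (PBackward v l) =
     {([tgt G e, e, src G e], var_assignment v e) |e. e \<in> edges G \<and> label_ok G l e}"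
| "pattern_sem G (PUnion \<pi> \<rho>) =
     {(p, \<mu> |` pattern_singles (PUnion \<pi> \<rho>)) |p \<mu>.
        (p, \<mu>) \<in> pattern_sem G \<pi> \<union> pattern_sem G \<rho>}"
| "pattern_sem G (PConcat \<pi> \<rho>) =
     {(path_concat p q, \<mu> ++ \<nu>) |p q \<mu> \<nu>.
        (p, \<mu>) \<in> pattern_sem G \<pi> \<and> (q, \<nu>) \<in> pattern_sem G \<rho> \<and> concatenate p q \<and> agree \<mu> \<nu>}"
| "pattern_sem G (PCond \<pi> \<theta>) = {(p, \<mu>). (p, \<mu>) \<in> pattern_sem G \<pi> \<and> sat G \<mu> \<theta>}"
| "pattern_sem G (PRepeat \<pi> n m) =
     {(p, Map.empty) |p. \<exists>k. n \<le> k \<and> enat k \<le> m \<and> p \<in> path_power G (fst ` pattern_sem G \<pi>) k}"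

fun restrict_matches :: "restrictor \<Rightarrow> (path \<times> assignment) set \<Rightarrow> (path \<times> assignment) set" where
  "restrict_matches Simple M = {(p, \<mu>) \<in> M. distinct (path_nodes p)}"
| "restrict_matches Trail M = {(p, \<mu>) \<in> M. distinct (path_edges p)}"
| "restrict_matches Shortest M =
     {(p, \<mu>) \<in> M. \<forall>(q, \<nu>) \<in> M. hd q = hd p \<longrightarrow> last q = last p \<longrightarrow> path_length p \<le> path_length q}"

fun gpc_sem :: "pgraph \<Rightarrow> gpc \<Rightarrow> assignment set" where
  "gpc_sem G (QPath r \<pi>) = snd ` restrict_matches r (pattern_sem G \<pi>)"
| "gpc_sem G (QJoin P Q) =
     {\<mu> ++ \<nu> |\<mu> \<nu>. \<mu> \<in> gpc_sem G P \<and> \<nu> \<in> gpc_sem G Q \<and> agree \<mu> \<nu>}"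
| "gpc_sem G (QCond Q \<theta>) = {\<mu> \<in> gpc_sem G Q. sat G \<mu> \<theta>}"

definition bindings :: "pgraph \<Rightarrow> gpc \<Rightarrow> var list \<Rightarrow> oid list set" where
  "bindings G P xs = (\<lambda>\<mu>. map (\<lambda>x. the (\<mu> x)) xs) ` gpc_sem G P"

definition satisfiable :: "gpc \<Rightarrow> bool" where
  "satisfiable P \<longleftrightarrow> (\<exists>G. property_graph G \<and> gpc_sem G P \<noteq> {})"


section \<open>Transformations\<close>

datatype id_item = IConst const | ILabel label | IVar var | IProp var key

datatype val = VConst const | VProp var key

datatype content =
  Content (content_id: "id_item list") (content_labels: "label fset")
    (content_props: "(key \<times> val) list")

datatype rule =
    NodeRule gpc "var list" content
  | EdgeRule gpc "var list" content content content
      \<comment> \<open>contents of the source, the edge and the target, in this order\<close>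

fun id_item_vars :: "id_item \<Rightarrow> var set" where
  "id_item_vars (IVar x) = {x}"
| "id_item_vars (IProp x a) = {x}"
| "id_item_vars _ = {}"

fun val_vars :: "val \<Rightarrow> var set" where
  "val_vars (VConst c) = {}"
| "val_vars (VProp x a) = {x}"

definition content_vars :: "content \<Rightarrow> var set" where
  "content_vars C =
     (\<Union>i \<in> set (content_id C). id_item_vars i) \<union> (\<Union>(k, v) \<in> set (content_props C). val_vars v)"

fun rule_ok :: "rule \<Rightarrow> bool" where
  "rule_ok (NodeRule P xs C) \<longleftrightarrow>
     well_typed P \<and> set xs \<subseteq> gpc_singles P \<and> content_vars C \<subseteq> set xs"
| "rule_ok (EdgeRule P xs Cs C Ct) \<longleftrightarrow>
     well_typed P \<and> set xs \<subseteq> gpc_singles P \<and>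
     content_vars Cs \<union> content_vars C \<union> content_vars Ct \<subseteq> set xs"

definition transformation :: "rule set \<Rightarrow> bool" where
  "transformation T \<longleftrightarrow> finite T \<and> (\<forall>r \<in> T. rule_ok r)"

datatype atom = AObj oid | AConst const | ALabel label

text \<open>
  Expressions \<open>x.a\<close> whose value is undefined: an identifier tuple mentioning one is undefined and
  then no element is created for that binding; a property assignment \<open>k = x.a\<close> is skipped.
\<close>

fun eval_id_item :: "pgraph \<Rightarrow> assignment \<Rightarrow> id_item \<Rightarrow> atom option" where
  "eval_id_item G b (IConst c) = Some (AConst c)"
| "eval_id_item G b (ILabel l) = Some (ALabel l)"
| "eval_id_item G b (IVar x) = map_option AObj (b x)"
| "eval_id_item G b (IProp x a) = map_option AConst (var_prop G b x a)"

fun eval_val :: "pgraph \<Rightarrow> assignment \<Rightarrow> val \<Rightarrow> const option" where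
  "eval_val G b (VConst c) = Some c"
| "eval_val G b (VProp x a) = var_prop G b x a"

definition eval_id :: "pgraph \<Rightarrow> assignment \<Rightarrow> content \<Rightarrow> atom list option" where
  "eval_id G b C = those (map (eval_id_item G b) (content_id C))"

definition eval_props :: "pgraph \<Rightarrow> assignment \<Rightarrow> content \<Rightarrow> (key \<times> const) list" where
  "eval_props G b C = List.map_filter (\<lambda>(k, v). map_option (Pair k) (eval_val G b v)) (content_props C)"


section \<open>Execution and consistency\<close>

text \<open>
  An execution state is the output graph built so far together with a flag recording whether
  some previously set property has been reset to a different value.
\<close>

type_synonym exec_state = "pgraph \<times> bool"

definition initial_state :: exec_state where
  "initial_state =
     (\<lparr>nodes = {}, edges = {}, labs = (\<lambda>_. {}), src = (\<lambda>_. undefined), tgt = (\<lambda>_. undefined),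
       attr = (\<lambda>_ _. None)\<rparr>, False)"

definition set_prop :: "oid \<Rightarrow> key \<times> const \<Rightarrow> exec_state \<Rightarrow> exec_state" where
  "set_prop u = (\<lambda>(k, c) (H, conflict).
     (H\<lparr>attr := (attr H)(u := (attr H u)(k := Some c))\<rparr>,
      conflict \<or> (\<exists>d. attr H u k = Some d \<and> d \<noteq> c)))"

definition add_content :: "pgraph \<Rightarrow> assignment \<Rightarrow> oid \<Rightarrow> content \<Rightarrow> exec_state \<Rightarrow> exec_state" where
  "add_content G b u C = (\<lambda>(H, conflict).
     fold (set_prop u) (eval_props G b C)
       (H\<lparr>labs := (labs H)(u := labs H u \<union> fset (content_labels C))\<rparr>, conflict))"

type_synonym node_task = "(gpc \<times> var list \<times> content) \<times> oid list"
type_synonym edge_task = "(gpc \<times> var list \<times> content \<times> content \<times> content) \<times> oid list"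

definition binding_map :: "var list \<Rightarrow> oid list \<Rightarrow> assignment" where
  "binding_map xs os = map_of (zip xs os)"

definition node_step ::
  "(atom list \<Rightarrow> oid) \<Rightarrow> pgraph \<Rightarrow> node_task \<Rightarrow> exec_state \<Rightarrow> exec_state" where
  "node_step f G = (\<lambda>((P, xs, C), os) (H, conflict).
     let b = binding_map xs os in
     case eval_id G b C of
       None \<Rightarrow> (H, conflict)
     | Some i \<Rightarrow>
         let u = f i in add_content G b u C (H\<lparr>nodes := insert u (nodes H)\<rparr>, conflict))"

definition edge_step ::
  "(atom list \<Rightarrow> oid) \<Rightarrow> pgraph \<Rightarrow> edge_task \<Rightarrow> exec_state \<Rightarrow> exec_state" where
  "edge_step f G = (\<lambda>((P, xs, Cs, C, Ct), os) (H, conflict).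
     let b = binding_map xs os in
     case (eval_id G b Cs, eval_id G b C, eval_id G b Ct) of
       (Some is, Some i, Some it) \<Rightarrow>
         let us = f is; ut = f it; u = f (AObj us # i @ [AObj ut]) in
         add_content G b u C
           (H\<lparr>edges := insert u (edges H), src := (src H)(u := us), tgt := (tgt H)(u := ut)\<rparr>,
            conflict)
     | _ \<Rightarrow> (H, conflict))"

text \<open>Edge rules contribute the node rules creating their sources and targets.\<close>

definition node_rules :: "rule set \<Rightarrow> (gpc \<times> var list \<times> content) set" where
  "node_rules T =
     {(P, xs, C) |P xs C. NodeRule P xs C \<in> T} \<union>
     {(P, xs, Cs) |P xs Cs. \<exists>C Ct. EdgeRule P xs Cs C Ct \<in> T} \<union>
     {(P, xs, Ct) |P xs Ct. \<exists>Cs C. EdgeRule P xs Cs C Ct \<in> T}"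

definition node_tasks :: "rule set \<Rightarrow> pgraph \<Rightarrow> node_task set" where
  "node_tasks T G = {((P, xs, C), os) |P xs C os. (P, xs, C) \<in> node_rules T \<and> os \<in> bindings G P xs}"

definition edge_tasks :: "rule set \<Rightarrow> pgraph \<Rightarrow> edge_task set" where
  "edge_tasks T G =
     {((P, xs, Cs, C, Ct), os) |P xs Cs C Ct os. EdgeRule P xs Cs C Ct \<in> T \<and> os \<in> bindings G P xs}"

text \<open>The final states of all executions, one for each order of the node tasks and of the edge tasks.\<close>

definition executions :: "(atom list \<Rightarrow> oid) \<Rightarrow> rule set \<Rightarrow> pgraph \<Rightarrow> exec_state set" where
  "executions f T G =
     {fold (edge_step f G) es (fold (node_step f G) ns initial_state) |ns es.
        distinct ns \<and> set ns = node_tasks T G \<and> distinct es \<and> set es = edge_tasks T G}"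

definition consistent :: "oid set \<Rightarrow> (atom list \<Rightarrow> oid) \<Rightarrow> rule set \<Rightarrow> bool" where
  "consistent S f T \<longleftrightarrow>
     (\<forall>G. property_graph G \<and> nodes G \<union> edges G \<subseteq> S \<longrightarrow>
        (\<forall>(H, conflict) \<in> executions f T G. \<not> conflict))"


section \<open>Encoding instances as binary words\<close>

text \<open>
  All numbers, including identifiers of variables, labels, keys and constants and the bounds of
  repetitions, are written in binary.  The codes are prefix-free: a list is written by
  putting \<open>True\<close> in front of every entry and \<open>False\<close> at the end, and a constructor by a number
  followed by the codes of its arguments.
\<close>

type_synonym word = "bool list"

fun bits :: "nat \<Rightarrow> word" where
  "bits n = (if n = 0 then [] else odd n # bits (n div 2))"

declare bits.simps [simp del]

definition enc_list :: "('a \<Rightarrow> word) \<Rightarrow> 'a list \<Rightarrow> word" where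
  "enc_list e xs = concat (map (\<lambda>x. True # e x) xs) @ [False]"

definition enc_nat :: "nat \<Rightarrow> word" where
  "enc_nat n = enc_list (\<lambda>b. [b]) (bits n)"

fun enc_option :: "nat option \<Rightarrow> word" where
  "enc_option None = [False]"
| "enc_option (Some n) = True # enc_nat n"

fun enc_enat :: "enat \<Rightarrow> word" where
  "enc_enat \<infinity> = [False]"
| "enc_enat (enat n) = True # enc_nat n"

fun enc_cond :: "cond \<Rightarrow> word" where
  "enc_cond (CConst x a c) = enc_nat 0 @ enc_nat x @ enc_nat a @ enc_nat c"
| "enc_cond (CProp x a y b) = enc_nat 1 @ enc_nat x @ enc_nat a @ enc_nat y @ enc_nat b"
| "enc_cond (CAnd s t) = enc_nat 2 @ enc_cond s @ enc_cond t"
| "enc_cond (COr s t) = enc_nat 3 @ enc_cond s @ enc_cond t"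
| "enc_cond (CNot t) = enc_nat 4 @ enc_cond t"

fun enc_pattern :: "pattern \<Rightarrow> word" where
  "enc_pattern (PNode v l) = enc_nat 0 @ enc_option v @ enc_option l"
| "enc_pattern (PForward v l) = enc_nat 1 @ enc_option v @ enc_option l"
| "enc_pattern (PBackward v l) = enc_nat 2 @ enc_option v @ enc_option l"
| "enc_pattern (PUnion \<pi> \<rho>) = enc_nat 3 @ enc_pattern \<pi> @ enc_pattern \<rho>"
| "enc_pattern (PConcat \<pi> \<rho>) = enc_nat 4 @ enc_pattern \<pi> @ enc_pattern \<rho>"
| "enc_pattern (PCond \<pi> \<theta>) = enc_nat 5 @ enc_pattern \<pi> @ enc_cond \<theta>"
| "enc_pattern (PRepeat \<pi> n m) = enc_nat 6 @ enc_pattern \<pi> @ enc_nat n @ enc_enat m"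

fun enc_restrictor :: "restrictor \<Rightarrow> word" where
  "enc_restrictor Simple = enc_nat 0"
| "enc_restrictor Trail = enc_nat 1"
| "enc_restrictor Shortest = enc_nat 2"

fun enc_gpc :: "gpc \<Rightarrow> word" where
  "enc_gpc (QPath r \<pi>) = enc_nat 0 @ enc_restrictor r @ enc_pattern \<pi>"
| "enc_gpc (QJoin P Q) = enc_nat 1 @ enc_gpc P @ enc_gpc Q"
| "enc_gpc (QCond Q \<theta>) = enc_nat 2 @ enc_gpc Q @ enc_cond \<theta>"

fun enc_id_item :: "id_item \<Rightarrow> word" where
  "enc_id_item (IConst c) = enc_nat 0 @ enc_nat c"
| "enc_id_item (ILabel l) = enc_nat 1 @ enc_nat l"
| "enc_id_item (IVar x) = enc_nat 2 @ enc_nat x"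
| "enc_id_item (IProp x a) = enc_nat 3 @ enc_nat x @ enc_nat a"

fun enc_val :: "val \<Rightarrow> word" where
  "enc_val (VConst c) = enc_nat 0 @ enc_nat c"
| "enc_val (VProp x a) = enc_nat 1 @ enc_nat x @ enc_nat a"

fun enc_content :: "content \<Rightarrow> word" where
  "enc_content (Content i L ps) =
     enc_list enc_id_item i @ enc_list enc_nat (sorted_list_of_fset L) @
     enc_list (\<lambda>(k, v). enc_nat k @ enc_val v) ps"

fun enc_rule :: "rule \<Rightarrow> word" where
  "enc_rule (NodeRule P xs C) = enc_nat 0 @ enc_gpc P @ enc_list enc_nat xs @ enc_content C"
| "enc_rule (EdgeRule P xs Cs C Ct) =
     enc_nat 1 @ enc_gpc P @ enc_list enc_nat xs @ enc_content Cs @ enc_content C @ enc_content Ct"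

text \<open>A transformation is encoded by listing its rules, in any order.\<close>

definition encodes_transformation :: "word \<Rightarrow> rule set \<Rightarrow> bool" where
  "encodes_transformation w T \<longleftrightarrow> (\<exists>rs. distinct rs \<and> set rs = T \<and> w = enc_list enc_rule rs)"


text \<open>The encodings are unambiguous.\<close>

lemma enc_list_cancel:
  assumes "\<And>x y u v. x \<in> set xs \<Longrightarrow> e x @ u = e y @ v \<Longrightarrow> x = y \<and> u = v"
  shows "enc_list e xs @ u = enc_list e ys @ v \<Longrightarrow> xs = ys \<and> u = v"
  using assms
proof (induction xs arbitrary: ys)
  case Nil then show ?case by (cases ys) (auto simp: enc_list_def)
next
  case (Cons x xs)
  obtain y zs where ys: "ys = y # zs"
    using Cons.prems(1) by (cases ys) (auto simp: enc_list_def)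
  have "e x @ (enc_list e xs @ u) = e y @ (enc_list e zs @ v)"
    using Cons.prems(1) by (simp add: enc_list_def ys)
  then have "x = y" "enc_list e xs @ u = enc_list e zs @ v"
    using Cons.prems(2) by force+
  with Cons.IH Cons.prems(2) ys show ?case by (metis list.set_intros(2))
qed

lemma bits_inj: "bits m = bits n \<Longrightarrow> m = n"
proof (induction m arbitrary: n rule: bits.induct)
  case (1 m)
  show ?case
  proof (cases "m = 0 \<or> n = 0")
    case True then show ?thesis using "1.prems" by (subst (asm) (1 2) bits.simps) (auto split: if_splits)
  next
    case False
    then have "odd m = odd n" "bits (m div 2) = bits (n div 2)"
      using "1.prems" by (subst (asm) (1 2) bits.simps, simp)+
    then have "odd m = odd n" "m div 2 = n div 2" using "1.IH" False by auto
    then show ?thesis by (metis bit_eq_rec)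
  qed
qed

lemma enc_nat_cancel: "enc_nat m @ u = enc_nat n @ v \<longleftrightarrow> m = n \<and> u = v"
proof
  assume "enc_nat m @ u = enc_nat n @ v"
  then have "bits m = bits n \<and> u = v" unfolding enc_nat_def
    by (rule enc_list_cancel[rotated]) auto
  then show "m = n \<and> u = v" using bits_inj by blast
qed auto

lemma enc_option_cancel: "enc_option m @ u = enc_option n @ v \<longleftrightarrow> m = n \<and> u = v"
  by (cases m; cases n) (auto simp: enc_nat_cancel)

lemma enc_enat_cancel: "enc_enat m @ u = enc_enat n @ v \<longleftrightarrow> m = n \<and> u = v"
  by (cases m; cases n) (auto simp: enc_nat_cancel)

lemma enc_cond_cancel: "enc_cond s @ u = enc_cond t @ v \<longleftrightarrow> s = t \<and> u = v"
proof (induction s arbitrary: t u v)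
qed (case_tac t; simp add: enc_nat_cancel)+

lemma enc_pattern_cancel: "enc_pattern s @ u = enc_pattern t @ v \<longleftrightarrow> s = t \<and> u = v"
proof (induction s arbitrary: t u v)
qed (case_tac t; simp add: enc_nat_cancel enc_option_cancel enc_enat_cancel enc_cond_cancel)+

lemma enc_restrictor_cancel: "enc_restrictor r @ u = enc_restrictor s @ v \<longleftrightarrow> r = s \<and> u = v"
  by (cases r; cases s) (auto simp: enc_nat_cancel)

lemma enc_gpc_cancel: "enc_gpc s @ u = enc_gpc t @ v \<longleftrightarrow> s = t \<and> u = v"
proof (induction s arbitrary: t u v)
qed (case_tac t; simp add: enc_nat_cancel enc_restrictor_cancel enc_cond_cancel enc_pattern_cancel)+

lemma enc_id_item_cancel: "enc_id_item s @ u = enc_id_item t @ v \<Longrightarrow> s = t \<and> u = v"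
  by (cases s; cases t) (auto simp: enc_nat_cancel)

lemma enc_val_cancel: "enc_val s @ u = enc_val t @ v \<Longrightarrow> s = t \<and> u = v"
  by (cases s; cases t) (auto simp: enc_nat_cancel)

lemma enc_nats_cancel: "enc_list enc_nat xs @ u = enc_list enc_nat ys @ v \<Longrightarrow> xs = ys \<and> u = v"
  by (rule enc_list_cancel) (auto simp: enc_nat_cancel)

lemma enc_content_cancel: "enc_content s @ u = enc_content t @ v \<Longrightarrow> s = t \<and> u = v"
proof (cases s; cases t)
  fix i L p j K q
  let ?e = "\<lambda>(k, v). enc_nat k @ enc_val v"
  assume a: "s = Content i L p" "t = Content j K q" "enc_content s @ u = enc_content t @ v"
  have "i = j \<and> enc_list enc_nat (sorted_list_of_fset L) @ enc_list ?e p @ u =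
      enc_list enc_nat (sorted_list_of_fset K) @ enc_list ?e q @ v"
    by (rule enc_list_cancel[where e = enc_id_item]) (use a enc_id_item_cancel in auto)
  moreover from this have "sorted_list_of_fset L = sorted_list_of_fset K \<and> enc_list ?e p @ u = enc_list ?e q @ v"
    using enc_nats_cancel by blast
  moreover from this have "p = q \<and> u = v"
    by (intro enc_list_cancel[where e = ?e]) (auto simp: enc_nat_cancel dest: enc_val_cancel)
  ultimately show ?thesis using a by (metis sorted_list_of_fset_simps(1) fset_inject)
qed

lemma enc_rule_cancel: "enc_rule s @ u = enc_rule t @ v \<Longrightarrow> s = t \<and> u = v"
  by (cases s; cases t) (auto simp: enc_nat_cancel enc_gpc_cancel dest!: enc_nats_cancel enc_content_cancel)

lemma enc_gpc_inject: "enc_gpc P = enc_gpc Q \<longleftrightarrow> P = Q"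
  using enc_gpc_cancel[of P "[]" Q "[]"] by auto

lemma encodes_transformation_unique:
  "encodes_transformation w T \<Longrightarrow> encodes_transformation w U \<Longrightarrow> T = U"
  using enc_list_cancel[where e = enc_rule and u = "[]" and v = "[]"] enc_rule_cancel
  unfolding encodes_transformation_def by (metis append_Nil2)


section \<open>Decision problems\<close>

text \<open>
  A decision problem is given by its positive and its negative instances; words that do not
  encode an instance belong to neither (\<open>promise problem\<close>).
\<close>

record problem =
  yes_instances :: "word set"
  no_instances :: "word set"

definition complement :: "problem \<Rightarrow> problem" where
  "complement A = \<lparr>yes_instances = no_instances A, no_instances = yes_instances A\<rparr>"

definition gpc_satisfiability :: problem where
  "gpc_satisfiability =
     \<lparr>yes_instances = {enc_gpc P |P. well_typed P \<and> satisfiable P},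
      no_instances = {enc_gpc P |P. well_typed P \<and> \<not> satisfiable P}\<rparr>"

definition transformation_consistency :: "oid set \<Rightarrow> (atom list \<Rightarrow> oid) \<Rightarrow> problem" where
  "transformation_consistency S f =
     \<lparr>yes_instances =
        {w. \<exists>T. encodes_transformation w T \<and> transformation T \<and> consistent S f T},
      no_instances =
        {w. \<exists>T. encodes_transformation w T \<and> transformation T \<and> \<not> consistent S f T}\<rparr>"

lemma gpc_satisfiability_disjoint:
  "yes_instances gpc_satisfiability \<inter> no_instances gpc_satisfiability = {}"
  by (auto simp: gpc_satisfiability_def enc_gpc_inject)

lemma transformation_consistency_disjoint:
  "yes_instances (transformation_consistency S f) \<inter> no_instances (transformation_consistency S f) = {}"
proof -
  have False
    if "encodes_transformation w T" "consistent S f T" "encodes_transformation w U" "\<not> consistent S f U"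
    for w T U
    using that(2,4) encodes_transformation_unique[OF that(1,3)] by simp
  then show ?thesis unfolding transformation_consistency_def by (simp, blast)
qed


section \<open>Polynomial-time reducibility\<close>

text \<open>
  Deterministic multi-tape oracle Turing machines.  States are numbers below \<open>num_states\<close>, tape
  symbols are numbers below \<open>num_symbols\<close>; symbol \<open>0\<close> is the blank, \<open>1\<close> and \<open>2\<close> are the input
  symbols \<open>False\<close> and \<open>True\<close>.  Tapes are infinite in both directions; tape \<open>0\<close> initially holds
  the input, and tape \<open>1\<close> is both the output tape and the oracle tape.  In the query state the
  machine passes in one step to one of the two answer states, depending on whether the word on
  the oracle tape belongs to the oracle.
\<close>

datatype move = Move_Left | Stay | Move_Right

record machine =
  num_tapes :: nat
  num_symbols :: nat
  num_states :: nat
  start_state :: nat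
  accept_state :: nat
  reject_state :: nat
  query_state :: nat
  yes_state :: nat
  no_state :: nat
  trans :: "nat \<Rightarrow> nat list \<Rightarrow> nat \<times> (nat \<times> move) list"

definition machine :: "machine \<Rightarrow> bool" where
  "machine M \<longleftrightarrow>
     2 \<le> num_tapes M \<and> 3 \<le> num_symbols M \<and>
     {start_state M, accept_state M, reject_state M, query_state M, yes_state M, no_state M}
       \<subseteq> {..<num_states M} \<and>
     distinct [accept_state M, reject_state M, query_state M] \<and>
     (\<forall>q rs. q < num_states M \<and> length rs = num_tapes M \<and> set rs \<subseteq> {..<num_symbols M} \<longrightarrow>
        (case trans M q rs of (q', acts) \<Rightarrow>
           q' < num_states M \<and> length acts = num_tapes M \<and> fst ` set acts \<subseteq> {..<num_symbols M}))"

type_synonym tape = "(int \<Rightarrow> nat) \<times> int"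
type_synonym config = "nat \<times> tape list"

definition symbol :: "bool \<Rightarrow> nat" where
  "symbol b = (if b then 2 else 1)"

definition word_tape :: "word \<Rightarrow> tape" where
  "word_tape w =
     ((\<lambda>i. if 0 \<le> i \<and> i < int (length w) then symbol (w ! nat i) else 0), 0)"

text \<open>The word starting at position \<open>0\<close> and ending before the first blank.\<close>

definition holds_word :: "tape \<Rightarrow> word \<Rightarrow> bool" where
  "holds_word t w \<longleftrightarrow>
     (\<forall>i < length w. fst t (int i) = symbol (w ! i)) \<and> fst t (int (length w)) = 0"

definition init_config :: "machine \<Rightarrow> word \<Rightarrow> config" where
  "init_config M w = (start_state M, word_tape w # replicate (num_tapes M - 1) (word_tape []))"

fun act :: "nat \<times> move \<Rightarrow> tape \<Rightarrow> tape" where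
  "act (a, m) (t, i) =
     (t(i := a), case m of Move_Left \<Rightarrow> i - 1 | Stay \<Rightarrow> i | Move_Right \<Rightarrow> i + 1)"

definition step :: "word set \<Rightarrow> machine \<Rightarrow> config \<Rightarrow> config" where
  "step X M = (\<lambda>(q, ts).
     if q = accept_state M \<or> q = reject_state M then (q, ts)
     else if q = query_state M then
       (if \<exists>w \<in> X. holds_word (ts ! 1) w then yes_state M else no_state M, ts)
     else case trans M q (map (\<lambda>(t, i). t i) ts) of (q', acts) \<Rightarrow> (q', map2 act acts ts))"

definition run :: "word set \<Rightarrow> machine \<Rightarrow> word \<Rightarrow> nat \<Rightarrow> config" where
  "run X M w n = (step X M ^^ n) (init_config M w)"

text \<open>With the empty oracle every query is answered negatively, so queries give no extra power.\<close>

definition ptime_computable :: "(word \<Rightarrow> word) \<Rightarrow> bool" where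
  "ptime_computable g \<longleftrightarrow>
     (\<exists>M (p :: nat poly). machine M \<and>
        (\<forall>w. \<exists>n \<le> poly p (length w). \<exists>ts.
           run {} M w n = (accept_state M, ts) \<and> holds_word (ts ! 1) (g w)))"

definition ptime_many_one_reducible :: "problem \<Rightarrow> problem \<Rightarrow> bool" where
  "ptime_many_one_reducible A B \<longleftrightarrow>
     (\<exists>g. ptime_computable g \<and>
        g ` yes_instances A \<subseteq> yes_instances B \<and> g ` no_instances A \<subseteq> no_instances B)"

text \<open>
  The oracle may answer arbitrarily on words that are not instances of \<open>B\<close>.
\<close>

definition oracle_for :: "problem \<Rightarrow> word set \<Rightarrow> bool" where
  "oracle_for B X \<longleftrightarrow> yes_instances B \<subseteq> X \<and> no_instances B \<inter> X = {}"

definition ptime_Turing_reducible :: "problem \<Rightarrow> problem \<Rightarrow> bool" where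
  "ptime_Turing_reducible A B \<longleftrightarrow>
     (\<exists>M (p :: nat poly). machine M \<and>
        (\<forall>X w. oracle_for B X \<longrightarrow>
           (\<exists>n \<le> poly p (length w). \<exists>q ts.
              run X M w n = (q, ts) \<and> q \<in> {accept_state M, reject_state M} \<and>
              (w \<in> yes_instances A \<longrightarrow> q = accept_state M) \<and>
              (w \<in> no_instances A \<longrightarrow> q = reject_state M))))"

end

theory Submission
  imports Defs "HOL-Library.Infinite_Set"
begin

text \<open>
  A query is reduced to the transformation whose only rule fires on every match of the query and
  sets one property of one node to two different constants: it is consistent iff the query is
  unsatisfiable.  The graph witnessing satisfiability has to be moved to identifiers from \<open>S\<close>, so
  the semantics must be invariant under injective renaming.  In the chosen encoding the query
  occurs verbatim in the code of the transformation, so the reduction merely surrounds its input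
  by two constant words.
\<close>

section \<open>Invariance under renaming of identifiers\<close>

text \<open>Outside the range of \<open>h\<close> the value of \<open>inv h\<close> is arbitrary.
  Only \<open>attr\<close> is guarded against this, since \<open>property_graph\<close> demands
  undefined properties off the graph's elements.\<close>

definition rename_graph :: "(oid \<Rightarrow> oid) \<Rightarrow> pgraph \<Rightarrow> pgraph" where
  "rename_graph h G =
     \<lparr>nodes = h ` nodes G, edges = h ` edges G,
      labs = (\<lambda>y. labs G (inv h y)),
      src = (\<lambda>y. h (src G (inv h y))), tgt = (\<lambda>y. h (tgt G (inv h y))),
      attr = (\<lambda>y. if y \<in> range h then attr G (inv h y) else (\<lambda>_. None))\<rparr>"

definition rename_assignment :: "(oid \<Rightarrow> oid) \<Rightarrow> assignment \<Rightarrow> assignment" where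
  "rename_assignment h \<mu> = map_option h \<circ> \<mu>"

definition rename_match :: "(oid \<Rightarrow> oid) \<Rightarrow> path \<times> assignment \<Rightarrow> path \<times> assignment" where
  "rename_match h = map_prod (map h) (rename_assignment h)"

lemma rename_match_simp [simp]: "rename_match h (p, \<mu>) = (map h p, rename_assignment h \<mu>)"
  by (simp add: rename_match_def)

lemma rename_graph_simps [simp]:
  "nodes (rename_graph h G) = h ` nodes G"
  "edges (rename_graph h G) = h ` edges G"
  by (simp_all add: rename_graph_def)

lemma rename_graph_inj_simps:
  assumes "inj h"
  shows "labs (rename_graph h G) (h u) = labs G u"
    "src (rename_graph h G) (h u) = h (src G u)"
    "tgt (rename_graph h G) (h u) = h (tgt G u)"
    "attr (rename_graph h G) (h u) = attr G u"
    "label_ok (rename_graph h G) l (h u) = label_ok G l u"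
  using assms by (simp_all add: rename_graph_def label_ok_def split: option.split)

lemma property_graph_rename:
  assumes "inj h" "property_graph G"
  shows "property_graph (rename_graph h G)"
proof -
  \<comment> \<open>As an image of the old domain, the new domain of \<open>attr\<close> is
    finite.\<close>
  have "{(y, a). attr (rename_graph h G) y a \<noteq> None} = map_prod h id ` {(x, a). attr G x a \<noteq> None}"
    using assms(1) by (auto simp: rename_graph_def image_iff split: if_splits) blast
  moreover have "h ` nodes G \<inter> h ` edges G = {}"
    using assms by (metis image_Int image_empty property_graph_def)
  moreover have "y \<in> h ` nodes G \<union> h ` edges G" if "attr (rename_graph h G) y a \<noteq> None" for y a
    using that assms unfolding property_graph_def
    by (auto simp: rename_graph_def split: if_splits) (metis imageI)
  ultimately show ?thesis
    using assms unfolding property_graph_def by (auto simp: rename_graph_inj_simps)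
qed

lemma rename_assignment_simps [simp]:
  "rename_assignment h Map.empty = Map.empty"
  "rename_assignment h (\<mu> ++ \<nu>) = rename_assignment h \<mu> ++ rename_assignment h \<nu>"
  "rename_assignment h (\<mu> |` X) = rename_assignment h \<mu> |` X"
  "rename_assignment h (var_assignment v u) = var_assignment v (h u)"
  by (auto simp: rename_assignment_def var_assignment_def map_add_def restrict_map_def
      split: option.split)

lemma agree_rename:
  "inj h \<Longrightarrow> agree (rename_assignment h \<mu>) (rename_assignment h \<nu>) = agree \<mu> \<nu>"
  unfolding agree_def rename_assignment_def dom_def
  by (auto simp: inj_eq Ball_def)

lemma sat_rename:
  "inj h \<Longrightarrow> sat (rename_graph h G) (rename_assignment h \<mu>) \<theta> = sat G \<mu> \<theta>"
proof (induction \<theta>)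
qed (auto simp: var_prop_def rename_assignment_def rename_graph_inj_simps split: option.splits)

section \<open>Paths and pattern matches under renaming\<close>

lemma path_concat_map: "path_concat (map h p) (map h q) = map h (path_concat p q)"
  by (simp add: path_concat_def map_tl)

text \<open>On nonempty lists \<open>hd\<close> and \<open>last\<close> commute with
  \<open>map h\<close>, and injectivity of \<open>h\<close> ensures that renaming makes no new pair
  of paths composable.\<close>

lemma concatenate_map:
  "inj h \<Longrightarrow> p \<noteq> [] \<Longrightarrow> q \<noteq> [] \<Longrightarrow> concatenate (map h p) (map h q) = concatenate p q"
  by (simp add: concatenate_def last_map hd_map inj_eq)

lemma path_power_nonempty: "[] \<notin> A \<Longrightarrow> [] \<notin> path_power G A k"
  by (induction k) (auto simp: path_concat_def)

text \<open>Supplies the nonemptiness needed wherever endpoints of renamed paths are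
  compared.\<close>

lemma pattern_sem_nonempty: "(p, \<mu>) \<in> pattern_sem G \<pi> \<Longrightarrow> p \<noteq> []"
proof (induction \<pi> arbitrary: p \<mu>)
  case (PRepeat \<pi> n m)
  then show ?case using path_power_nonempty[of "fst ` pattern_sem G \<pi>" G] by force
qed (auto simp: path_concat_def)

lemma path_power_rename:
  assumes "inj h" "[] \<notin> A"
  shows "path_power (rename_graph h G) (map h ` A) k = map h ` path_power G A k"
proof (induction k)
  case 0
  show ?case by (simp add: Setcompr_eq_image image_image)
next
  case (Suc k)
  have *: "concatenate (map h p) (map h q) = concatenate p q" if "p \<in> A" "q \<in> path_power G A k" for p q
    using that assms path_power_nonempty[OF assms(2)] by (metis concatenate_map)
  show ?case
  proof (intro set_eqI iffI)
    fix r assume "r \<in> path_power (rename_graph h G) (map h ` A) (Suc k)"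
    then show "r \<in> map h ` path_power G A (Suc k)" using * by (auto simp: Suc path_concat_map) blast
  next
    fix r assume "r \<in> map h ` path_power G A (Suc k)"
    then show "r \<in> path_power (rename_graph h G) (map h ` A) (Suc k)"
      using * by (auto simp: Suc) (metis imageI path_concat_map)
  qed
qed

text \<open>By induction on the pattern. Apart from concatenation, each case rewrites the semantics
  as an image, a filter or a union, with which renaming commutes.\<close>

lemma pattern_sem_rename:
  assumes "inj h"
  shows "pattern_sem (rename_graph h G) \<pi> = rename_match h ` pattern_sem G \<pi>"
proof -
  \<comment> \<open>Pulls the label test on renamed elements back to the original graph.\<close>
  have sub: "{x \<in> h ` A. Q x} = h ` {x \<in> A. Q (h x)}" for A Q by auto
  show ?thesis
  proof (induction \<pi>)
    case (PNode v l)
    have "pattern_sem K (PNode v l) =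
        (\<lambda>n. ([n], var_assignment v n)) ` {n \<in> nodes K. label_ok K l n}" for K
      by auto
    then show ?case
      by (simp only: sub rename_graph_simps) (simp add: rename_graph_inj_simps[OF assms] image_image)
  next
    case (PForward v l)
    have "pattern_sem K (PForward v l) =
        (\<lambda>e. ([src K e, e, tgt K e], var_assignment v e)) ` {e \<in> edges K. label_ok K l e}" for K
      by auto
    then show ?case
      by (simp only: sub rename_graph_simps) (simp add: rename_graph_inj_simps[OF assms] image_image)
  next
    case (PBackward v l)
    have "pattern_sem K (PBackward v l) =
        (\<lambda>e. ([tgt K e, e, src K e], var_assignment v e)) ` {e \<in> edges K. label_ok K l e}" for K
      by auto
    then show ?case
      by (simp only: sub rename_graph_simps) (simp add: rename_graph_inj_simps[OF assms] image_image)
  next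
    case (PUnion \<pi> \<rho>)
    have *: "pattern_sem K (PUnion \<pi> \<rho>) =
        (\<lambda>(p, \<mu>). (p, \<mu> |` pattern_singles (PUnion \<pi> \<rho>))) ` (pattern_sem K \<pi> \<union> pattern_sem K \<rho>)" for K
      by auto
    show ?case
      unfolding * PUnion by (simp add: image_image image_Un case_prod_unfold rename_match_def)
  next
    case (PConcat \<pi> \<rho>)
    let ?M = "pattern_sem G \<pi>" and ?N = "pattern_sem G \<rho>"
    have *: "concatenate (map h p) (map h q) = concatenate p q"
      if "(p, \<mu>) \<in> ?M" "(q, \<nu>) \<in> ?N" for p q \<mu> \<nu>
      using that assms pattern_sem_nonempty by (metis concatenate_map)
    show ?case
    proof (intro set_eqI iffI)
      fix r assume "r \<in> pattern_sem (rename_graph h G) (PConcat \<pi> \<rho>)"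
      then obtain p q \<mu> \<nu> where r: "(p, \<mu>) \<in> ?M" "(q, \<nu>) \<in> ?N" "concatenate p q" "agree \<mu> \<nu>"
        "r = rename_match h (path_concat p q, \<mu> ++ \<nu>)"
        using * assms by (auto simp: PConcat path_concat_map agree_rename)
      then have "(path_concat p q, \<mu> ++ \<nu>) \<in> pattern_sem G (PConcat \<pi> \<rho>)" by auto
      with r(5) show "r \<in> rename_match h ` pattern_sem G (PConcat \<pi> \<rho>)" by blast
    next
      fix r assume "r \<in> rename_match h ` pattern_sem G (PConcat \<pi> \<rho>)"
      then obtain p q \<mu> \<nu> where r: "(p, \<mu>) \<in> ?M" "(q, \<nu>) \<in> ?N" "concatenate p q" "agree \<mu> \<nu>"
        "r = (path_concat (map h p) (map h q), rename_assignment h \<mu> ++ rename_assignment h \<nu>)"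
        by (auto simp: path_concat_map)
      moreover have "(map h p, rename_assignment h \<mu>) \<in> rename_match h ` ?M"
        "(map h q, rename_assignment h \<nu>) \<in> rename_match h ` ?N"
        using r(1,2) by force+
      moreover have "concatenate (map h p) (map h q)" "agree (rename_assignment h \<mu>) (rename_assignment h \<nu>)"
        using r *[OF r(1,2)] agree_rename[OF assms] by simp_all
      ultimately show "r \<in> pattern_sem (rename_graph h G) (PConcat \<pi> \<rho>)"
        unfolding pattern_sem.simps PConcat by blast
    qed
  next
    case (PCond \<pi> \<theta>)
    have *: "pattern_sem K (PCond \<pi> \<theta>) = {x \<in> pattern_sem K \<pi>. sat K (snd x) \<theta>}" for K
      by auto
    show ?case
      unfolding * PCond by (auto simp: rename_match_def sat_rename[OF assms])
  next
    case (PRepeat \<pi> n m)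
    have *: "pattern_sem K (PRepeat \<pi> n m) =
        (\<lambda>p. (p, Map.empty)) ` (\<Union>k \<in> {k. n \<le> k \<and> enat k \<le> m}. path_power K (fst ` pattern_sem K \<pi>) k)" for K
      by auto
    have "[] \<notin> fst ` pattern_sem G \<pi>" using pattern_sem_nonempty by fastforce
    then have "path_power (rename_graph h G) (fst ` pattern_sem (rename_graph h G) \<pi>) k =
        map h ` path_power G (fst ` pattern_sem G \<pi>) k" for k
      using path_power_rename[OF assms, of "fst ` pattern_sem G \<pi>" G k]
      by (simp add: PRepeat image_image rename_match_def)
    then show ?case
      unfolding * by (simp only: image_UN image_image rename_match_simp rename_assignment_simps)
  qed
qed

section \<open>Restrictors and queries under renaming\<close>

lemma path_map_simps [simp]:
  "path_nodes (map h p) = map h (path_nodes p)"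
  "path_edges (map h p) = map h (path_edges p)"
  "path_length (map h p) = path_length p"
  by (simp_all add: path_nodes_def path_edges_def path_length_def nths_map)

text \<open>An injective map preserves and reflects repetitions in a path. For
  \<open>Shortest\<close>, renamed paths share endpoints exactly if the originals do, and lengths
  are unchanged, so the same competitors are compared.\<close>

lemma restrict_matches_rename:
  assumes "inj h" and ne: "\<And>p \<mu>. (p, \<mu>) \<in> M \<Longrightarrow> p \<noteq> []"
  shows "restrict_matches r (rename_match h ` M) = rename_match h ` restrict_matches r M"
proof (cases r)
  case Shortest
  let ?shorter = "\<lambda>x y. hd (fst y) = hd (fst x) \<longrightarrow> last (fst y) = last (fst x) \<longrightarrow>
    path_length (fst x) \<le> path_length (fst y)"
  have shortest: "restrict_matches Shortest N = {x \<in> N. \<forall>y \<in> N. ?shorter x y}" for N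
    by (simp add: case_prod_unfold)
  have "?shorter (rename_match h x) (rename_match h y) \<longleftrightarrow> ?shorter x y" if "x \<in> M" "y \<in> M" for x y
    using ne[of "fst x" "snd x"] ne[of "fst y" "snd y"] that assms(1)
    by (simp add: rename_match_def hd_map last_map inj_eq)
  then show ?thesis
    unfolding Shortest shortest by blast
qed (use assms in \<open>auto simp: distinct_map inj_on_subset[of h UNIV]\<close>)

lemma gpc_sem_rename:
  assumes "inj h"
  shows "gpc_sem (rename_graph h G) P = rename_assignment h ` gpc_sem G P"
proof (induction P)
  case (QPath r \<pi>)
  have "restrict_matches r (rename_match h ` pattern_sem G \<pi>) =
      rename_match h ` restrict_matches r (pattern_sem G \<pi>)"
    using assms pattern_sem_nonempty by (rule restrict_matches_rename)
  then show ?case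
    by (simp add: pattern_sem_rename[OF assms] image_image rename_match_def)
next
  case (QJoin P Q)
  show ?case
    by (auto simp: QJoin agree_rename[OF assms] image_iff)
      (metis agree_rename[OF assms] rename_assignment_simps(2))+
next
  case (QCond P \<theta>)
  then show ?case using assms by (auto simp: sat_rename)
qed

text \<open>Satisfiability allows arbitrary identifiers, consistency only inputs over
  \<open>S\<close>. The enumeration of \<open>S\<close> injects all identifiers into
  \<open>S\<close>, and the renamed witness still has answers.\<close>

lemma satisfiable_over_infinite_set:
  assumes "infinite S" "satisfiable P"
  obtains G where "property_graph G" "nodes G \<union> edges G \<subseteq> S" "gpc_sem G P \<noteq> {}"
proof -
  obtain G where G: "property_graph G" "gpc_sem G P \<noteq> {}"
    using assms(2) unfolding satisfiable_def by blast
  let ?h = "enumerate S"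
  have "inj ?h" using assms(1) strict_mono_enumerate strict_mono_imp_inj_on by blast
  moreover have "range ?h \<subseteq> S" using assms(1) by (auto simp: enumerate_in_set)
  ultimately show ?thesis
    using G by (intro that[of "rename_graph ?h G"]) (auto simp: property_graph_rename gpc_sem_rename)
qed


section \<open>The conflicting rule\<close>

text \<open>The empty identifier tuple is always defined and yields the node \<open>f []\<close>.
  Two different constants for key \<open>0\<close> make a single task conflict with itself.\<close>

definition conflict_content :: content where
  "conflict_content = Content [] {||} [(0, VConst 0), (0, VConst 1)]"

definition conflict_rule :: "gpc \<Rightarrow> rule" where
  "conflict_rule P = NodeRule P [] conflict_content"

text \<open>With no output variables all matches collapse to the one binding \<open>[]\<close>, so
  there is at most one task.\<close>

lemma node_tasks_conflict_rule:
  "node_tasks {conflict_rule P} G = (if gpc_sem G P = {} then {} else {((P, [], conflict_content), [])})"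
  by (auto simp: node_tasks_def node_rules_def conflict_rule_def bindings_def)

lemma edge_tasks_conflict_rule: "edge_tasks {conflict_rule P} G = {}"
  by (auto simp: edge_tasks_def conflict_rule_def)

text \<open>A single task admits only one order, hence only one execution.\<close>

lemma distinct_set_singleton: "distinct xs \<and> set xs = {x} \<longleftrightarrow> xs = [x]"
  by (cases xs) (auto simp: subset_singleton_iff)

lemma executions_conflict_rule:
  "executions f {conflict_rule P} G =
     {if gpc_sem G P = {} then initial_state
      else node_step f G ((P, [], conflict_content), []) initial_state}"
  by (auto simp: executions_def node_tasks_conflict_rule edge_tasks_conflict_rule
      distinct_set_singleton)

lemma conflict_node_step: "snd (node_step f G ((P, [], conflict_content), []) initial_state)"
  by (simp add: node_step_def conflict_content_def eval_id_def initial_state_def add_content_def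
      eval_props_def set_prop_def List.map_filter_def Let_def)

lemma consistent_conflict_rule:
  assumes "infinite S"
  shows "consistent S f {conflict_rule P} \<longleftrightarrow> \<not> satisfiable P"
proof
  assume c: "consistent S f {conflict_rule P}"
  show "\<not> satisfiable P"
  proof
    assume "satisfiable P"
    then obtain G where G: "property_graph G" "nodes G \<union> edges G \<subseteq> S" "gpc_sem G P \<noteq> {}"
      using satisfiable_over_infinite_set[OF assms] by metis
    then have "\<forall>(H, conflict) \<in> executions f {conflict_rule P} G. \<not> conflict"
      using c unfolding consistent_def by blast
    then show False
      using G(3) conflict_node_step[of f G P] by (simp add: executions_conflict_rule split_beta)
  qed
next
  assume "\<not> satisfiable P"
  then show "consistent S f {conflict_rule P}"
    by (auto simp: consistent_def executions_conflict_rule satisfiable_def initial_state_def)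
qed

lemma transformation_conflict_rule: "well_typed P \<Longrightarrow> transformation {conflict_rule P}"
  by (simp add: transformation_def conflict_rule_def content_vars_def conflict_content_def)

section \<open>The reduction on encoded instances\<close>

definition code_prefix :: word where
  "code_prefix = True # enc_nat 0"

text \<open>The final \<open>False\<close> closes the list of rules; its counterpart in
  \<open>code_prefix\<close> is the \<open>True\<close> announcing the only rule, followed by the
  constructor number of \<open>NodeRule\<close>.\<close>

definition code_suffix :: word where
  "code_suffix = enc_list enc_nat [] @ enc_content conflict_content @ [False]"

definition reduction :: "word \<Rightarrow> word" where
  "reduction w = code_prefix @ w @ code_suffix"

lemma encodes_conflict_rule: "encodes_transformation (reduction (enc_gpc P)) {conflict_rule P}"
  unfolding encodes_transformation_def
  by (rule exI[of _ "[conflict_rule P]"])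
    (simp add: reduction_def code_prefix_def code_suffix_def conflict_rule_def enc_list_def)

lemma reduction_yes_instance:
  assumes "infinite S" "w \<in> yes_instances gpc_satisfiability"
  shows "reduction w \<in> no_instances (transformation_consistency S f)"
  using assms encodes_conflict_rule transformation_conflict_rule consistent_conflict_rule
  by (fastforce simp: gpc_satisfiability_def transformation_consistency_def)

lemma reduction_no_instance:
  assumes "infinite S" "w \<in> no_instances gpc_satisfiability"
  shows "reduction w \<in> yes_instances (transformation_consistency S f)"
  using assms encodes_conflict_rule transformation_conflict_rule consistent_conflict_rule
  by (fastforce simp: gpc_satisfiability_def transformation_consistency_def)


section \<open>A machine surrounding its input by two words\<close>

text \<open>
  States below \<open>length u\<close> write \<open>u\<close>, state \<open>length u\<close> copies the input and the following
  \<open>length v\<close> states write \<open>v\<close>; the state \<open>length u + length v + 1\<close> is the first one that is not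
  left by an ordinary transition.
\<close>

definition surround_trans :: "word \<Rightarrow> word \<Rightarrow> nat \<Rightarrow> nat list \<Rightarrow> nat \<times> (nat \<times> move) list" where
  "surround_trans u v q rs =
     (if q < length u then (q + 1, [(rs ! 0, Stay), (symbol (u ! q), Move_Right)])
      else if q = length u then
        (if rs ! 0 = 0 then (q + 1, [(rs ! 0, Stay), (rs ! 1, Stay)])
         else (q, [(rs ! 0, Move_Right), (rs ! 0, Move_Right)]))
      else if q \<le> length u + length v then
        (q + 1, [(rs ! 0, Stay), (symbol (v ! (q - length u - 1)), Move_Right)])
      else (q, [(rs ! 0, Stay), (rs ! 1, Stay)]))"

text \<open>The last five arguments are offsets of the special states beyond the writing phase.
  Different choices give a machine computing a function and one querying an oracle.\<close>

definition surround_machine :: "word \<Rightarrow> word \<Rightarrow> nat \<Rightarrow> nat \<Rightarrow> nat \<Rightarrow> nat \<Rightarrow> nat \<Rightarrow> machine" where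
  "surround_machine u v acc rej qu yes no =
     \<lparr>num_tapes = 2, num_symbols = 3, num_states = length u + length v + 4, start_state = 0,
      accept_state = length u + length v + 1 + acc,
      reject_state = length u + length v + 1 + rej,
      query_state = length u + length v + 1 + qu,
      yes_state = length u + length v + 1 + yes,
      no_state = length u + length v + 1 + no,
      trans = surround_trans u v\<rparr>"

lemma symbol_bounds [simp]: "symbol b < 3" "symbol b \<noteq> 0" "symbol b = symbol c \<longleftrightarrow> b = c"
  by (auto simp: symbol_def)

lemma machine_surround:
  assumes "distinct [acc, rej, qu]" "{acc, rej, qu, yes, no} \<subseteq> {..<3}"
  shows "machine (surround_machine u v acc rej qu yes no)"
proof -
  have "rs ! 0 < 3 \<and> rs ! 1 < 3" if "length rs = 2" "set rs \<subseteq> {..<3}" for rs :: "nat list"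
    using that nth_mem[of 0 rs] nth_mem[of 1 rs] by (auto simp: subset_iff)
  then show ?thesis
    using assms unfolding machine_def surround_machine_def
    by (auto simp: surround_trans_def)
qed

text \<open>The head stands on the first blank after the word: the invariant of the output tape
  while it is being written.\<close>

definition written_tape :: "word \<Rightarrow> tape" where
  "written_tape w = (fst (word_tape w), int (length w))"

lemma written_tape_Nil: "written_tape [] = word_tape []"
  by (simp add: written_tape_def word_tape_def)

lemma act_written_tape: "act (symbol b, Move_Right) (written_tape w) = written_tape (w @ [b])"
  by (auto simp: written_tape_def word_tape_def fun_eq_iff nth_append)

lemma act_id: "act (fst t (snd t), Stay) t = t"
  by (cases t) simp

lemma holds_written_tape: "holds_word (written_tape w) w"
  by (simp add: holds_word_def written_tape_def word_tape_def)

text \<open>Symbols of a word are never blank, so the first blank fixes the length. Hence an oracle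
  query tests membership of exactly the word written.\<close>

lemma holds_word_unique:
  assumes "holds_word t v" "holds_word t w"
  shows "v = w"
proof (rule nth_equalityI)
  show "length v = length w"
    using assms unfolding holds_word_def by (metis linorder_neqE_nat symbol_bounds(2))
  then show "v ! i = w ! i" if "i < length v" for i
    using assms that unfolding holds_word_def by (metis symbol_bounds(3))
qed

section \<open>Runs of the surrounding machine\<close>

context
  fixes u v :: word and acc rej qu yes no :: nat and X :: "word set" and M :: machine
  defines "M \<equiv> surround_machine u v acc rej qu yes no"
begin

lemma step_surround:
  assumes "q \<le> length u + length v"
  shows "step X M (q, [s, t]) =
    (case surround_trans u v q [fst s (snd s), fst t (snd t)] of
       (q', acts) \<Rightarrow> (q', map2 act acts [s, t]))"
  using assms by (simp add: step_def M_def surround_machine_def split_beta)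

lemma run_Suc: "run X M w (Suc n) = step X M (run X M w n)"
  by (simp add: run_def)

lemma run_prefix: "n \<le> length u \<Longrightarrow> run X M w n = (n, [word_tape w, written_tape (take n u)])"
proof (induction n)
  case 0
  show ?case
    by (simp add: run_def init_config_def M_def surround_machine_def written_tape_Nil numeral_2_eq_2)
next
  case (Suc n)
  then show ?case
    by (simp add: run_Suc step_surround surround_trans_def act_id act_written_tape take_Suc_conv_app_nth)
qed

lemma run_copy:
  "k \<le> length w \<Longrightarrow>
   run X M w (length u + k) = (length u, [(fst (word_tape w), int k), written_tape (u @ take k w)])"
proof (induction k)
  case 0
  show ?case using run_prefix[of "length u" w] by (simp add: word_tape_def)
next
  case (Suc k)
  have "fst (word_tape w) (int k) = symbol (w ! k)" using Suc.prems by (simp add: word_tape_def)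
  \<comment> \<open>Writing back the symbol just read leaves the input tape unchanged.\<close>
  moreover have "(fst (word_tape w))(int k := symbol (w ! k)) = fst (word_tape w)"
    using calculation by (metis fun_upd_triv)
  ultimately show ?case
    using Suc by (simp add: run_Suc step_surround surround_trans_def act_written_tape
        take_Suc_conv_app_nth add.commute)
qed

text \<open>The additional \<open>1\<close> in the step count is the step in which the copying state
  reads the blank after the input and moves on without writing.\<close>

lemma run_suffix:
  "j \<le> length v \<Longrightarrow>
   run X M w (length u + length w + 1 + j) =
     (length u + 1 + j, [(fst (word_tape w), int (length w)), written_tape (u @ w @ take j v)])"
proof (induction j)
  case 0
  have "fst (word_tape w) (int (length w)) = 0" by (simp add: word_tape_def)
  then show ?case
    using run_copy[of "length w" w] act_id[of "(fst (word_tape w), int (length w))"]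
    by (simp add: run_Suc step_surround surround_trans_def act_id)
next
  case (Suc j)
  then show ?case
    using act_id[of "(fst (word_tape w), int (length w))"]
    by (simp add: run_Suc step_surround surround_trans_def act_written_tape take_Suc_conv_app_nth)
qed

lemma run_surround:
  obtains s where "run X M w (length u + length w + 1 + length v) =
    (length u + length v + 1, [s, written_tape (u @ w @ v)])"
  using run_suffix[of "length v" w] by (simp add: add_ac)

end

section \<open>The two kinds of polynomial-time reduction\<close>

lemma ptime_computable_surround: "ptime_computable (\<lambda>w. u @ w @ v)"
proof -
  \<comment> \<open>Offset \<open>0\<close> makes the machine accept as soon as the suffix is
    written; \<open>?p\<close> is the exact number of steps.\<close>
  let ?M = "surround_machine u v 0 1 2 0 0"
  let ?p = "[:length u + length v + 1, 1:]"
  have "\<exists>n \<le> poly ?p (length w). \<exists>ts. run {} ?M w n = (accept_state ?M, ts) \<and> holds_word (ts ! 1) (u @ w @ v)"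
    for w
  proof -
    obtain s where "run {} ?M w (length u + length w + 1 + length v) =
        (length u + length v + 1, [s, written_tape (u @ w @ v)])"
      by (rule run_surround)
    then show ?thesis
      by (intro exI[of _ "length u + length w + 1 + length v"])
        (auto simp: surround_machine_def holds_written_tape)
  qed
  moreover have "machine ?M" by (rule machine_surround) auto
  ultimately show ?thesis unfolding ptime_computable_def by blast
qed

lemma query_after_surround:
  assumes "M = surround_machine u v 1 2 0 yes no"
  shows "\<exists>ts. run X M w (length u + length w + length v + 2) =
    (length u + length v + 1 + (if u @ w @ v \<in> X then yes else no), ts)"
proof -
  obtain s where s: "run X M w (length u + length w + 1 + length v) =
      (length u + length v + 1, [s, written_tape (u @ w @ v)])"
    unfolding assms by (rule run_surround)
  have "(\<exists>x \<in> X. holds_word (written_tape (u @ w @ v)) x) \<longleftrightarrow> u @ w @ v \<in> X"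
    using holds_written_tape holds_word_unique by blast
  then have "step X M (length u + length v + 1, [s, written_tape (u @ w @ v)]) =
      (length u + length v + 1 + (if u @ w @ v \<in> X then yes else no), [s, written_tape (u @ w @ v)])"
    by (simp add: step_def assms surround_machine_def)
  then show ?thesis using s by (simp add: run_def add_ac)
qed

text \<open>The machine queries the oracle once and inverts the answer.\<close>

lemma ptime_Turing_reducible_complement_surround:
  assumes yes: "\<And>w. w \<in> yes_instances A \<Longrightarrow> u @ w @ v \<in> no_instances B"
    and no: "\<And>w. w \<in> no_instances A \<Longrightarrow> u @ w @ v \<in> yes_instances B"
  shows "ptime_Turing_reducible A B"
proof -
  \<comment> \<open>The query state comes right after the suffix. A positive answer leads to offset
    \<open>2\<close>, the rejecting state, and a negative one to offset \<open>1\<close>, the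
    accepting state.\<close>
  let ?M = "surround_machine u v 1 2 0 2 1"
  let ?p = "[:length u + length v + 2, 1:]"
  have "\<exists>n \<le> poly ?p (length w). \<exists>q ts.
      run X ?M w n = (q, ts) \<and> q \<in> {accept_state ?M, reject_state ?M} \<and>
      (w \<in> yes_instances A \<longrightarrow> q = accept_state ?M) \<and> (w \<in> no_instances A \<longrightarrow> q = reject_state ?M)"
    if "oracle_for B X" for X w
  proof -
    obtain ts where "run X ?M w (length u + length w + length v + 2) =
        (length u + length v + 1 + (if u @ w @ v \<in> X then 2 else 1), ts)"
      using query_after_surround by blast
    moreover have "w \<in> yes_instances A \<Longrightarrow> u @ w @ v \<notin> X" "w \<in> no_instances A \<Longrightarrow> u @ w @ v \<in> X"
      using that yes no unfolding oracle_for_def by blast+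
    ultimately show ?thesis
      by (intro exI[of _ "length u + length w + length v + 2"])
        (auto simp: surround_machine_def)
  qed
  moreover have "machine ?M" by (rule machine_surround) auto
  ultimately show ?thesis unfolding ptime_Turing_reducible_def by blast
qed

theorem lemma4p2:
  fixes S T :: "oid set" and f :: "atom list \<Rightarrow> oid"
  assumes "infinite S" and "S \<inter> T = {}" and "inj f" and "range f \<subseteq> T"
  shows "ptime_Turing_reducible gpc_satisfiability (transformation_consistency S f) \<and>
         ptime_many_one_reducible gpc_satisfiability (complement (transformation_consistency S f))"
proof
  show "ptime_Turing_reducible gpc_satisfiability (transformation_consistency S f)"
    using reduction_yes_instance[OF assms(1)] reduction_no_instance[OF assms(1)]
    unfolding reduction_def by (rule ptime_Turing_reducible_complement_surround)
  have "ptime_computable reduction"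
    unfolding reduction_def[abs_def] by (rule ptime_computable_surround)
  \<comment> \<open>Complementing exchanges positive and negative instances and so absorbs the
    inversion of the answer.\<close>
  then show "ptime_many_one_reducible gpc_satisfiability (complement (transformation_consistency S f))"
    using reduction_yes_instance[OF assms(1)] reduction_no_instance[OF assms(1)]
    unfolding ptime_many_one_reducible_def complement_def by auto
qed

end
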